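(* Let $(\mathcal{I},\mathcal{T},\mathcal{B})$ be a regular model checking problem over a finite alphabet $\Sigma$, and run the learning-based procedure described in the context, with the learner being any automata learning algorithm that poses membership and equivalence queries. If the procedure terminates, then its answer is correct: if it halts with output "true" (together with a finite automaton $\mathcal{A}_h$), then $T^*(I)\cap B=\emptyset$, and if it halts with output "false" (together with a word $w$), then $T^*(I)\cap B\neq\emptyset$.
   Context: A regular model checking (RMC) problem is a triple $(\mathcal{I},\mathcal{T},\mathcal{B})$ where $\mathcal{I}$ and $\mathcal{B}$ are finite automata over a finite alphabet $\Sigma$ recognising regular languages $I,B\subseteq\Sigma^*$ (initial and bad configurations), and $\mathcal{T}$ is a length-preserving finite transducer (every transition reads one letter and writes one letter of $\Sigma$) recognising a relation $T\subseteq\Sigma^*\times\Sigma^*$ with $|x|=|y|$ for all $(x,y)\in T$. For $X\subseteq\Sigma^*$, $T(X)=\{y\mid \exists x\in X, (x,y)\in T\}$, and $T^*(I)$ denotes the set of words reachable from $I$ by zero or more applications of $T$. The problem asks whether $T^*(I)\cap B=\emptyset$. The procedure consists of a learner (an automata learning algorithm) interacting with a teacher. Membership query on $w\in\Sigma^*$: the teacher answers yes iff $w\in T^*(I)$ (decidable since $T$ is length-preserving). Equivalence query on a candidate finite automaton $\mathcal{A}_h$ with language $A_h$: (1) if $I\not\subseteq A_h$, the teacher picks $w\in I\setminus A_h$ and returns it to the learner as a counterexample; (2) else if $A_h\cap B\neq\emptyset$, the teacher picks $w\in A_h\cap B$; if $w\in T^*(I)$ the procedure halts with output "false" and $w$,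 otherwise $w$ is returned to the learner as a counterexample; (3) else if $T(A_h)\not\subseteq A_h$, the teacher picks $(w,w')\in T$ with $w\in A_h$, $w'\notin A_h$; if $w\in T^*(I)$ it returns $w'$ as a counterexample, otherwise it returns $w$ as a counterexample; (4) otherwise the procedure halts with output "true" and $\mathcal{A}_h$ (an inductive invariant). *)

theory Defs
  imports Main
begin

record ('q, 'a) automaton =
  states :: "'q set"
  start :: 'q
  final :: "'q set"
  trans :: "('q \<times> 'a \<times> 'q) set"

definition finite_automaton :: "'a set \<Rightarrow> ('q, 'a) automaton \<Rightarrow> bool" where
  "finite_automaton \<Sigma> \<A> \<longleftrightarrow>
     finite (states \<A>) \<and> start \<A> \<in> states \<A> \<and> final \<A> \<subseteq> states \<A> \<and>
     trans \<A> \<subseteq> states \<A> \<times> \<Sigma> \<times> states \<A>"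

inductive path :: "('q, 'a) automaton \<Rightarrow> 'q \<Rightarrow> 'a list \<Rightarrow> 'q \<Rightarrow> bool" for \<A> where
  path_Nil: "path \<A> q [] q"
| path_Cons: "(q, a, q') \<in> trans \<A> \<Longrightarrow> path \<A> q' w q'' \<Longrightarrow> path \<A> q (a # w) q''"

definition language :: "('q, 'a) automaton \<Rightarrow> 'a list set" where
  "language \<A> = {w. \<exists>q \<in> final \<A>. path \<A> (start \<A>) w q}"

text \<open>A length-preserving transducer is a finite automaton whose letters are pairs
  (letter read, letter written).\<close>

definition relation_of :: "('q, 'a \<times> 'a) automaton \<Rightarrow> ('a list \<times> 'a list) set" where
  "relation_of \<T> = {(map fst w, map snd w) | w. w \<in> language \<T>}"

record ('a, 'i, 't, 'b) rmc =
  alphabet :: "'a set"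
  init_aut :: "('i, 'a) automaton"
  transducer :: "('t, 'a \<times> 'a) automaton"
  bad_aut :: "('b, 'a) automaton"

definition rmc_problem :: "('a, 'i, 't, 'b) rmc \<Rightarrow> bool" where
  "rmc_problem P \<longleftrightarrow>
     finite (alphabet P) \<and>
     finite_automaton (alphabet P) (init_aut P) \<and>
     finite_automaton (alphabet P \<times> alphabet P) (transducer P) \<and>
     finite_automaton (alphabet P) (bad_aut P)"

definition Init :: "('a, 'i, 't, 'b) rmc \<Rightarrow> 'a list set" where
  "Init P = language (init_aut P)"

definition Bad :: "('a, 'i, 't, 'b) rmc \<Rightarrow> 'a list set" where
  "Bad P = language (bad_aut P)"

definition Step :: "('a, 'i, 't, 'b) rmc \<Rightarrow> ('a list \<times> 'a list) set" where
  "Step P = relation_of (transducer P)"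

definition Reach :: "('a, 'i, 't, 'b) rmc \<Rightarrow> 'a list set" where
  "Reach P = (Step P)\<^sup>* `` Init P"

datatype ('a, 'h) query =
    Membership "'a list"
  | Equivalence "('h, 'a) automaton"

datatype 'a answer =
    Member bool
  | Counterexample "'a list"

type_synonym ('a, 'h) history = "(('a, 'h) query \<times> 'a answer) list"

text \<open>A learner is given by the queries it may pose after a history of answered queries
  (most recent first).  Any internal state is a function of this history and of the
  choices the learner has made, so that all deterministic, nondeterministic and randomised
  learning algorithms are covered.  Where the set of possible queries is empty the learner
  gives up, and the procedure yields no output.\<close>

type_synonym ('a, 'h) learner = "('a, 'h) history \<Rightarrow> ('a, 'h) query set"

fun query_over :: "'a set \<Rightarrow> ('a, 'h) query \<Rightarrow> bool" where
  "query_over \<Sigma> (Membership w) \<longleftrightarrow> w \<in> lists \<Sigma>"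
| "query_over \<Sigma> (Equivalence \<A>) \<longleftrightarrow> finite_automaton \<Sigma> \<A>"

definition learner_over :: "'a set \<Rightarrow> ('a, 'h) learner \<Rightarrow> bool" where
  "learner_over \<Sigma> L \<longleftrightarrow> (\<forall>h. \<forall>q \<in> L h. query_over \<Sigma> q)"

datatype ('a, 'h) outcome =
    OutTrue "('h, 'a) automaton"
  | OutFalse "'a list"

datatype ('a, 'h) reaction =
    Reply "'a answer"
  | Halt "('a, 'h) outcome"

text \<open>The teacher is a relation because it is free in its choice of the words it picks.\<close>

inductive teacher ::
  "('a, 'i, 't, 'b) rmc \<Rightarrow> ('a, 'h) query \<Rightarrow> ('a, 'h) reaction \<Rightarrow> bool" for P where
  membership:
    "teacher P (Membership w) (Reply (Member (w \<in> Reach P)))"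
| not_initial:
    "w \<in> Init P - language \<A> \<Longrightarrow>
     teacher P (Equivalence \<A>) (Reply (Counterexample w))"
| bad_reachable:
    "Init P \<subseteq> language \<A> \<Longrightarrow>
     w \<in> language \<A> \<inter> Bad P \<Longrightarrow> w \<in> Reach P \<Longrightarrow>
     teacher P (Equivalence \<A>) (Halt (OutFalse w))"
| bad_unreachable:
    "Init P \<subseteq> language \<A> \<Longrightarrow>
     w \<in> language \<A> \<inter> Bad P \<Longrightarrow> w \<notin> Reach P \<Longrightarrow>
     teacher P (Equivalence \<A>) (Reply (Counterexample w))"
| not_inductive_reachable:
    "Init P \<subseteq> language \<A> \<Longrightarrow> language \<A> \<inter> Bad P = {} \<Longrightarrow>
     (w, w') \<in> Step P \<Longrightarrow> w \<in> language \<A> \<Longrightarrow> w' \<notin> language \<A> \<Longrightarrow> w \<in> Reach P \<Longrightarrow>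
     teacher P (Equivalence \<A>) (Reply (Counterexample w'))"
| not_inductive_unreachable:
    "Init P \<subseteq> language \<A> \<Longrightarrow> language \<A> \<inter> Bad P = {} \<Longrightarrow>
     (w, w') \<in> Step P \<Longrightarrow> w \<in> language \<A> \<Longrightarrow> w' \<notin> language \<A> \<Longrightarrow> w \<notin> Reach P \<Longrightarrow>
     teacher P (Equivalence \<A>) (Reply (Counterexample w))"
| inductive_invariant:
    "Init P \<subseteq> language \<A> \<Longrightarrow> language \<A> \<inter> Bad P = {} \<Longrightarrow>
     Step P `` language \<A> \<subseteq> language \<A> \<Longrightarrow>
     teacher P (Equivalence \<A>) (Halt (OutTrue \<A>))"

datatype ('a, 'h) configuration =
    Running "('a, 'h) history"
  | Halted "('a, 'h) outcome"

inductive proc_step ::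
  "('a, 'i, 't, 'b) rmc \<Rightarrow> ('a, 'h) learner \<Rightarrow>
   ('a, 'h) configuration \<Rightarrow> ('a, 'h) configuration \<Rightarrow> bool" for P L where
  go_on:
    "q \<in> L h \<Longrightarrow> teacher P q (Reply a) \<Longrightarrow>
     proc_step P L (Running h) (Running ((q, a) # h))"
| stop:
    "q \<in> L h \<Longrightarrow> teacher P q (Halt out) \<Longrightarrow>
     proc_step P L (Running h) (Halted out)"

definition halts_with ::
  "('a, 'i, 't, 'b) rmc \<Rightarrow> ('a, 'h) learner \<Rightarrow> ('a, 'h) outcome \<Rightarrow> bool" where
  "halts_with P L out \<longleftrightarrow> (proc_step P L)\<^sup>*\<^sup>* (Running []) (Halted out)"

end

theory Submission
  imports Defs
begin

text \<open>Only the teacher's last reaction matters, so the learner is arbitrary.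
  \<open>OutTrue\<close> is issued only for an inductive language that contains
  \<open>Init P\<close> and avoids \<open>Bad P\<close>; such a language includes
  \<open>Reach P\<close>. \<open>OutFalse\<close> carries a word already checked to be reachable and
  bad.\<close>

lemma teacher_halt_if_halts_with:
  assumes "halts_with P L out"
  obtains q where "teacher P q (Halt out)"
proof -
  \<comment> \<open>The run starts in \<open>Running []\<close>, which is not halted, so it has a
    last step.\<close>
  from assms obtain c where "proc_step P L c (Halted out)"
    unfolding halts_with_def by (auto elim: rtranclp.cases)
  then show thesis
    by (auto elim: proc_step.cases intro: that)
qed

text \<open>A set closed under \<open>Step P\<close> is its own image under
  \<open>(Step P)\<^sup>*\<close>, and taking images is monotone.\<close>

lemma Reach_subset_if_inductive:
  assumes "Init P \<subseteq> X" and "Step P `` X \<subseteq> X"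
  shows "Reach P \<subseteq> X"
  using assms(1) Image_closed_trancl[OF assms(2)] unfolding Reach_def by blast

lemma teacher_OutTrue_sound:
  assumes "teacher P q (Halt (OutTrue \<A>))"
  shows "Reach P \<inter> Bad P = {}"
  using assms
proof cases
  case inductive_invariant
  then show ?thesis
    using Reach_subset_if_inductive[of P "language \<A>"] by blast
qed

lemma teacher_OutFalse_sound:
  assumes "teacher P q (Halt (OutFalse w))"
  shows "w \<in> Reach P \<inter> Bad P"
  using assms by cases auto

theorem mainTheorem1:
  fixes P :: "('a, 'i, 't, 'b) rmc"
    and L :: "('a, 'h) learner"
  assumes "rmc_problem P"
    and "learner_over (alphabet P) L"
  shows "(\<forall>\<A>. halts_with P L (OutTrue \<A>) \<longrightarrow> Reach P \<inter> Bad P = {}) \<and>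
         (\<forall>w. halts_with P L (OutFalse w) \<longrightarrow> Reach P \<inter> Bad P \<noteq> {})"
  by (blast elim: teacher_halt_if_halts_with
      dest: teacher_OutTrue_sound teacher_OutFalse_sound)

end
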